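(* Let $\varphi(z)=1+B_1z+B_2z^2+B_3z^3+B_4z^4+\cdots$ be as in the context, and suppose its coefficients satisfy all of the following four conditions: (C1) $\lvert B_1^3-2B_1B_2+2B_2^2\rvert<\lvert 2B_1^2-B_1^3-2B_1B_2\rvert$; (C2) $\lvert B_1^3-B_1^2B_2+3B_2^2-3B_1B_3\rvert<3\lvert B_1^3-B_1^2+B_2^2\rvert$; (C3) $\big\lvert B_1^7-B_1^6(8B_2+3)-6B_1^4\big(B_2(3B_2+2B_3+2)-6B_3+9B_4\big)+B_1^5\big(7B_2(B_2+4)-24B_3+18B_4\big)+6B_1^3\big(B_2^3-2B_2^2+8B_2B_3-3B_3^2+6(B_2+1)B_4\big)-6B_1B_2\big(3B_2^3-6B_3^2+B_2^2(4B_3-6)+6B_2(B_4-2B_3)\big)+18B_2^2\big(-2B_3^2+B_2((B_2-2)B_2+2B_4)\big)+B_1^2B_2\big(B_2(B_2(5B_2+6)-24B_3+18B_4)-36(2B_3+B_4)\big)\big\rvert<2\big\lvert\big((B_1-2)B_1+2B_2\big)\big(B_1(2B_1+B_2-3)+3B_3\big)\big(4B_1^3+6B_2^2-B_1^2(B_2+3)-3B_1B_3\big)\big\rvert$; (C4) $0<\dfrac{2B_1-B_1^2-2B_2}{2(B_1-B_2)}<1$. If $f(z)=z+a_2z^2+a_3z^3+\cdots\in\mathcal{C}_s(\varphi)$, then $$\lvert a_5\rvert\le\frac{B_1}{20}.$$ The bound is sharp, i.e. equality holds for some $f\in\mathcal{C}_s(\varphi)$.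
   Context: $\mathbb{D}$ is the open unit disk in $\mathbb{C}$, and $\mathcal{A}$ is the class of holomorphic functions $f$ on $\mathbb{D}$ with $f(0)=f'(0)-1=0$. The function $\varphi$ is analytic and univalent in $\mathbb{D}$ with $\varphi(0)=1$, $\operatorname{Re}\varphi(z)>0$ on $\mathbb{D}$, $\varphi(\mathbb{D})$ starlike with respect to $\varphi(0)=1$ and symmetric with respect to the real axis, and $\varphi(z)=1+B_1z+B_2z^2+\cdots$ with $B_1>0$ (so all $B_n$ are real). The symbol $\prec$ denotes subordination: $g\prec\varphi$ means $g=\varphi\circ\omega$ for some analytic $\omega:\mathbb{D}\to\mathbb{D}$ with $\omega(0)=0$. The class $\mathcal{C}_s(\varphi)$ consists of all $f\in\mathcal{A}$ such that $\dfrac{(2zf'(z))'}{(f(z)-f(-z))'}\prec\varphi(z)$. *)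

theory Defs
  imports "HOL-Complex_Analysis.Complex_Analysis"
begin

abbreviation disk :: "complex set" ("\<bbbD>") where
  "\<bbbD> \<equiv> ball 0 1"

abbreviation taylor_coeff :: "(complex \<Rightarrow> complex) \<Rightarrow> nat \<Rightarrow> complex" where
  "taylor_coeff f n \<equiv> fps_nth (fps_expansion f 0) n"

text \<open>Functions on the disk are total functions on \<^typ>\<open>complex\<close>; their values outside
  the disk are irrelevant.\<close>

definition normalized_class :: "(complex \<Rightarrow> complex) set" ("\<A>") where
  "\<A> = {f. f holomorphic_on \<bbbD> \<and> f 0 = 0 \<and> deriv f 0 - 1 = 0}"

text \<open>The last conjunct says \<open>B\<^sub>1 > 0\<close>, i.e. that the (a priori complex) first coefficient is a
  positive real. That the other coefficients are real is then a consequence, see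
  \<open>ma_minda_coeff_real\<close> below.\<close>

definition ma_minda :: "(complex \<Rightarrow> complex) \<Rightarrow> bool" where
  "ma_minda \<phi> \<longleftrightarrow>
     \<phi> holomorphic_on \<bbbD> \<and> inj_on \<phi> \<bbbD> \<and> \<phi> 0 = 1 \<and>
     (\<forall>z\<in>\<bbbD>. Re (\<phi> z) > 0) \<and>
     (\<forall>w\<in>\<phi> ` \<bbbD>. closed_segment (\<phi> 0) w \<subseteq> \<phi> ` \<bbbD>) \<and>
     (\<forall>w\<in>\<phi> ` \<bbbD>. cnj w \<in> \<phi> ` \<bbbD>) \<and>
     (\<exists>b>0. taylor_coeff \<phi> 1 = complex_of_real b)"

definition subordinate :: "(complex \<Rightarrow> complex) \<Rightarrow> (complex \<Rightarrow> complex) \<Rightarrow> bool" where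
  "subordinate g \<phi> \<longleftrightarrow>
     (\<exists>\<omega>. \<omega> holomorphic_on \<bbbD> \<and> \<omega> ` \<bbbD> \<subseteq> \<bbbD> \<and> \<omega> 0 = 0 \<and> (\<forall>z\<in>\<bbbD>. g z = \<phi> (\<omega> z)))"

text \<open>Where the denominator vanishes, the quotient below is 0 by convention. As
  \<open>Re \<phi> > 0\<close>, the subordination excludes this, so it forces the denominator to be
  zero-free on the disk.\<close>

definition class_Cs :: "(complex \<Rightarrow> complex) \<Rightarrow> (complex \<Rightarrow> complex) set" ("\<C>\<^sub>s") where
  "\<C>\<^sub>s \<phi> = {f \<in> \<A>.
     subordinate (\<lambda>z. deriv (\<lambda>w. 2 * w * deriv f w) z / deriv (\<lambda>w. f w - f (- w)) z) \<phi>}"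

definition real_coeff :: "(complex \<Rightarrow> complex) \<Rightarrow> nat \<Rightarrow> real" where
  "real_coeff \<phi> n = Re (taylor_coeff \<phi> n)"

lemma ma_minda_cnj:
  assumes "ma_minda \<phi>" "z \<in> \<bbbD>"
  shows "\<phi> z = cnj (\<phi> (cnj z))"
proof -
  have hol: "\<phi> holomorphic_on \<bbbD>" and inj: "inj_on \<phi> \<bbbD>" and phi0: "\<phi> 0 = 1"
    and sym: "\<And>w. w \<in> \<phi> ` \<bbbD> \<Longrightarrow> cnj w \<in> \<phi> ` \<bbbD>"
    using assms(1) by (auto simp: ma_minda_def)
  obtain b where b: "b > 0" "deriv \<phi> 0 = complex_of_real b"
    using assms(1) by (auto simp: ma_minda_def fps_expansion_def)
  define g where "g = (\<lambda>z. cnj (\<phi> (cnj z)))"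
  have gim: "g z \<in> \<phi> ` \<bbbD>" if "z \<in> \<bbbD>" for z
    unfolding g_def using that by (intro sym imageI) auto
  have der_g: "(g has_field_derivative cnj (deriv \<phi> (cnj z))) (at z)" if "z \<in> \<bbbD>" for z
  proof -
    have "(\<phi> has_field_derivative deriv \<phi> (cnj z)) (at (cnj z))"
      using that by (intro holomorphic_derivI[OF hol]) auto
    from has_field_derivative_cnj_cnj[OF this] show ?thesis
      by (simp add: g_def o_def)
  qed
  have g_hol: "g holomorphic_on \<bbbD>"
    unfolding holomorphic_on_open[OF open_ball] using der_g by blast
  obtain h where h: "h holomorphic_on \<phi> ` \<bbbD>"
      "\<And>z. z \<in> \<bbbD> \<Longrightarrow> deriv \<phi> z * deriv h (\<phi> z) = 1" "\<And>z. z \<in> \<bbbD> \<Longrightarrow> h (\<phi> z) = z"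
    using holomorphic_has_inverse[OF hol open_ball inj] by blast
  define \<omega> where "\<omega> = h \<circ> g"
  have \<omega>_hol: "\<omega> holomorphic_on \<bbbD>"
    unfolding \<omega>_def by (rule holomorphic_on_compose_gen[OF g_hol h(1)]) (use gim in auto)
  have \<phi>\<omega>: "\<omega> z \<in> \<bbbD>" "\<phi> (\<omega> z) = g z" if z: "z \<in> \<bbbD>" for z
  proof -
    obtain u where "u \<in> \<bbbD>" "g z = \<phi> u" using gim[OF z] by blast
    thus "\<omega> z \<in> \<bbbD>" "\<phi> (\<omega> z) = g z" using h(3)[of u] by (auto simp: \<omega>_def)
  qed
  have g0: "g 0 = \<phi> 0" by (simp add: g_def phi0)
  have \<omega>0: "\<omega> 0 = 0" using h(3)[of 0] g0 by (simp add: \<omega>_def)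
  have "deriv \<omega> 0 = 1"
  proof -
    have "open (\<phi> ` \<bbbD>)" by (rule open_mapping_thm3[OF hol open_ball inj])
    hence "(h has_field_derivative deriv h (g 0)) (at (g 0))"
      using gim[of 0] by (intro holomorphic_derivI[OF h(1)]) auto
    from DERIV_chain[OF this der_g[of 0]]
    have "deriv \<omega> 0 = deriv h (g 0) * cnj (deriv \<phi> 0)"
      unfolding \<omega>_def by (intro DERIV_imp_deriv) auto
    thus ?thesis using h(2)[of 0] b g0 by (simp add: mult.commute)
  qed
  hence "\<exists>\<alpha>. (\<forall>z. norm z < 1 \<longrightarrow> \<omega> z = \<alpha> * z) \<and> norm \<alpha> = 1"
    using \<phi>\<omega>(1) by (intro Schwarz_Lemma(3)[OF \<omega>_hol \<omega>0, of 0]) auto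
  then obtain \<alpha> where \<alpha>: "\<And>z. norm z < 1 \<Longrightarrow> \<omega> z = \<alpha> * z" by blast
  have "eventually (\<lambda>z. z \<in> \<bbbD>) (nhds (0::complex))"
    by (rule eventually_nhds_in_open) auto
  hence "eventually (\<lambda>z. \<omega> z = \<alpha> * z) (nhds 0)"
    by eventually_elim (use \<alpha> in auto)
  hence "deriv \<omega> 0 = deriv (\<lambda>z. \<alpha> * z) 0" by (rule deriv_cong_ev) auto
  hence "\<alpha> = 1" using \<open>deriv \<omega> 0 = 1\<close> by simp
  thus ?thesis using \<alpha>[of z] \<phi>\<omega>(2)[of z] assms(2) by (simp add: g_def)
qed

lemma ma_minda_coeff_real:
  assumes "ma_minda \<phi>"
  shows "taylor_coeff \<phi> n = complex_of_real (real_coeff \<phi> n)"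
proof -
  have hol: "\<phi> holomorphic_on \<bbbD>" using assms by (simp add: ma_minda_def)
  have "(deriv ^^ n) \<phi> z = cnj ((deriv ^^ n) \<phi> (cnj z))" if "z \<in> \<bbbD>" for z n
    using that
  proof (induction n arbitrary: z)
    case 0
    from ma_minda_cnj[OF assms this] show ?case by (simp only: funpow_0)
  next
    case (Suc n)
    define F where "F = (deriv ^^ n) \<phi>"
    have F_hol: "F holomorphic_on \<bbbD>"
      unfolding F_def by (intro holomorphic_higher_deriv hol) auto
    have "eventually (\<lambda>w. w \<in> \<bbbD>) (nhds z)"
      using Suc.prems by (intro eventually_nhds_in_open) auto
    hence "eventually (\<lambda>w. F w = cnj (F (cnj w))) (nhds z)"
      unfolding F_def by eventually_elim (rule Suc.IH)
    hence *: "deriv F z = deriv (\<lambda>w. cnj (F (cnj w))) z" by (rule deriv_cong_ev) auto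
    have "(F has_field_derivative deriv F (cnj z)) (at (cnj z))"
      using Suc.prems by (intro holomorphic_derivI[OF F_hol]) auto
    from has_field_derivative_cnj_cnj[OF this]
    have "((\<lambda>w. cnj (F (cnj w))) has_field_derivative cnj (deriv F (cnj z))) (at z)"
      by (simp add: o_def)
    hence "deriv (\<lambda>w. cnj (F (cnj w))) z = cnj (deriv F (cnj z))"
      by (rule DERIV_imp_deriv)
    with * have "deriv F z = cnj (deriv F (cnj z))" by (rule trans)
    thus ?case unfolding F_def funpow.simps o_apply .
  qed
  from this[of 0 n] have "cnj ((deriv ^^ n) \<phi> 0) = (deriv ^^ n) \<phi> 0"
    unfolding complex_cnj_zero by (metis centre_in_ball zero_less_one)
  hence "(deriv ^^ n) \<phi> 0 \<in> \<real>"
    unfolding Reals_cnj_iff .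
  moreover have "(fact n :: complex) \<in> \<real>" by (metis Reals_of_nat of_nat_fact)
  ultimately have "taylor_coeff \<phi> n \<in> \<real>" by (simp add: fps_expansion_def)
  thus ?thesis by (simp add: real_coeff_def)
qed

end

theory Submission
  imports Defs
begin

text \<open>
  Why the bound holds. Comparing coefficients in \<open>(2zf')' = (\<phi> \<circ> \<omega>) \<cdot> (f(z) - f(-z))'\<close> gives
  \<open>20 a\<^sub>5 = d\<^sub>4 + d\<^sub>2\<^sup>2/2\<close>, where \<open>d\<^sub>n\<close> are the coefficients of \<open>\<phi> \<circ> \<omega>\<close>. So \<open>20 a\<^sub>5 / B\<^sub>1\<close> is a
  polynomial in the first four coefficients of the Schwarz function \<open>\<omega>\<close>, with leading term \<open>c\<^sub>4\<close>
  (\<open>fifth_coeff_formula\<close>). The claim is that this polynomial is bounded by 1; equality occurs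
  for \<open>\<omega>(z) = z\<^sup>4\<close>, where only \<open>c\<^sub>4\<close> survives (\<open>extremal_function\<close>).

  In terms of \<open>p = (1 + \<omega>)/(1 - \<omega>)\<close>, which has positive real part, the polynomial becomes half of
  \<open>p\<^sub>4 - \<alpha> p\<^sub>1p\<^sub>3 - \<beta> p\<^sub>2\<^sup>2 + \<gamma> p\<^sub>1\<^sup>2p\<^sub>2 - \<delta> p\<^sub>1\<^sup>4\<close>. A family of such expressions is bounded by 2 for an
  elementary reason: if \<open>G = p - 1\<close> and \<open>|1 - 2y| = 1\<close>, then \<open>1 + (1 - 2y) G/(1 + yG)\<close> again has
  positive real part, so that the coefficients of \<open>G/(1 + yG) = G - yG\<^sup>2 + y\<^sup>2G\<^sup>3 - \<dots>\<close> have modulus at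
  most 2 (\<open>twisted_coeff4_le_2\<close>). Averaging over \<open>y\<close> with respect to a probability measure
  replaces \<open>1, y, y\<^sup>2, y\<^sup>3\<close> by moments, and yields every expression in which \<open>\<alpha> = 2\<beta>\<close> and the remaining
  coefficients form an admissible moment sequence.

  Here \<open>\<alpha>\<close> and \<open>2\<beta>\<close> differ. Their ratio is repaired by a Hadamard product: averaging \<open>p\<close> over
  the fourth roots of unity with suitable weights multiplies \<open>p\<^sub>1, p\<^sub>2, p\<^sub>3, p\<^sub>4\<close> by
  \<open>\<surd>\<rho>, \<rho>, \<surd>\<rho>, 1\<close> (\<open>caratheodory_rescale\<close>). The right \<open>\<rho>\<close> is the quotient in \<open>C4\<close>, and \<open>C4\<close> makes
  the weights positive. The hypotheses \<open>C1\<close>, \<open>C2\<close>, \<open>C3\<close> then say that the three Schur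
  parameters of the moment sequence lie in \<open>(-1, 1)\<close>, which is what makes it admissible
  (\<open>fifth_coeff_moments\<close>). Since all moments are real, the measure may be taken symmetric under
  conjugation, so that it is given by a measure on \<open>[0, 1]\<close> (the distribution of \<open>Re y\<close>) with three
  prescribed moments. Gauss quadrature provides one with two atoms (\<open>two_node_quadrature\<close>).
\<close>

section \<open>Truncated moments on the unit interval\<close>

text \<open>
  The nodes are the zeros of the quadratic orthogonal polynomial of the moment sequence
  \<open>1, M1, M2, M3\<close>. It is negative at the mean \<open>M1\<close>, and the last two hypotheses say that it is
  nonnegative at the end points of the interval, so it has a zero on either side of the mean.
\<close>
lemma two_node_quadrature:
  fixes M1 M2 M3 :: real
  assumes M1: "0 < M1" "M1 < 1"
    and v: "M1\<^sup>2 < M2"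
    and lower: "M2\<^sup>2 \<le> M1 * M3"
    and upper: "(M1 - M2)\<^sup>2 \<le> (1 - M1) * (M2 - M3)"
  obtains a b s t :: real where "a \<in> {0..1}" "b \<in> {0..1}" "0 \<le> s" "0 \<le> t" "s + t = 1"
    "s * a + t * b = M1" "s * a\<^sup>2 + t * b\<^sup>2 = M2" "s * a ^ 3 + t * b ^ 3 = M3"
proof -
  define v where "v = M2 - M1\<^sup>2"
  define Q where "Q = (\<lambda>u. v * u\<^sup>2 - (M3 - M1 * M2) * u + (M1 * M3 - M2\<^sup>2))"
  have vpos: "v > 0" using v by (simp add: v_def)
  have Q0: "Q 0 \<ge> 0" using lower by (simp add: Q_def)
  have Q1: "Q 1 \<ge> 0" using upper by (simp add: Q_def v_def power2_eq_square algebra_simps)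
  have "Q M1 = - (v\<^sup>2)" by (simp add: Q_def v_def power2_eq_square algebra_simps)
  hence QM: "Q M1 < 0" using vpos by simp
  have cont: "continuous_on A Q" for A unfolding Q_def by (intro continuous_intros)
  obtain a where a: "0 \<le> a" "a \<le> M1" "Q a = 0"
    using IVT2'[of Q M1 0 0] Q0 QM M1 cont by auto
  obtain b where b: "M1 \<le> b" "b \<le> 1" "Q b = 0"
    using IVT'[of Q M1 0 1] Q1 QM M1 cont by auto
  have "a < M1" "M1 < b" using a b QM by (auto simp: order.strict_iff_order)
  hence ab: "a < b" by simp
  have "Q a - Q b = (a - b) * (v * (a + b) - (M3 - M1 * M2))"
    by (simp add: Q_def power2_eq_square algebra_simps)
  hence sum: "v * (a + b) = M3 - M1 * M2" using a b ab by simp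
  have "v * a * b = a * (v * (a + b)) - v * a\<^sup>2"
    by (simp add: power2_eq_square algebra_simps)
  also have "\<dots> = M1 * M3 - M2\<^sup>2"
    unfolding sum using a(3) by (simp add: Q_def algebra_simps)
  finally have prod: "v * (a * b) = M1 * M3 - M2\<^sup>2" by simp
  define s t where "s = (b - M1) / (b - a)" and "t = (M1 - a) / (b - a)"
  have "s + t = (b - a) / (b - a)"
    by (simp add: s_def t_def flip: add_divide_distrib)
  moreover have "s * a + t * b = M1 * (b - a) / (b - a)"
    by (simp add: s_def t_def algebra_simps flip: add_divide_distrib)
  ultimately have st: "s + t = 1" "s * a + t * b = M1" using ab by simp_all
  \<comment> \<open>Both nodes satisfy the same quadratic equation, hence the power sums satisfy a linear recurrence.\<close>
  have rec: "s * a ^ Suc (Suc k) + t * b ^ Suc (Suc k)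
      = (a + b) * (s * a ^ Suc k + t * b ^ Suc k) - a * b * (s * a ^ k + t * b ^ k)" for k
    by (simp add: algebra_simps)
  have e: "s * a\<^sup>2 + t * b\<^sup>2 = (a + b) * M1 - a * b"
    using rec[of 0] by (simp add: st power2_eq_square)
  have "v * (s * a\<^sup>2 + t * b\<^sup>2) = v * (a + b) * M1 - v * (a * b)"
    unfolding e by (simp add: algebra_simps)
  also have "\<dots> = v * M2"
    unfolding sum prod by (simp add: v_def power2_eq_square algebra_simps)
  finally have m2: "s * a\<^sup>2 + t * b\<^sup>2 = M2" using vpos by simp
  have e: "s * a ^ 3 + t * b ^ 3 = (a + b) * M2 - a * b * M1"
    using rec[of 1] m2 by (simp add: st power2_eq_square power3_eq_cube)
  have "v * (s * a ^ 3 + t * b ^ 3) = v * (a + b) * M2 - v * (a * b) * M1"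
    unfolding e by (simp add: algebra_simps)
  also have "\<dots> = v * M3"
    unfolding sum prod by (simp add: v_def power2_eq_square algebra_simps)
  finally have m3: "s * a ^ 3 + t * b ^ 3 = M3" using vpos by simp
  show ?thesis
    by (rule that[of a b s t])
       (use a b ab st m2 m3 M1 in \<open>auto simp: s_def t_def intro!: divide_nonneg_nonneg\<close>)
qed

section \<open>Functions with positive real part\<close>

lemma holomorphic_imp_fps:
  assumes "f holomorphic_on \<bbbD>"
  shows "f has_fps_expansion fps_expansion f 0"
  using assms by (intro has_fps_expansion_fps_expansion[of \<bbbD>]) auto

lemma fps_expansion_eq_on_disk:
  assumes "f has_fps_expansion F" "g has_fps_expansion G" "\<And>z. z \<in> \<bbbD> \<Longrightarrow> f z = g z"
  shows "F = G"
proof -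
  have "eventually (\<lambda>z. z \<in> \<bbbD>) (nhds (0::complex))"
    by (rule eventually_nhds_in_open) auto
  hence "eventually (\<lambda>z. f z = g z) (nhds 0)"
    by eventually_elim (rule assms(3))
  hence "g has_fps_expansion F" using assms(1) has_fps_expansion_cong by blast
  thus ?thesis using assms(2) fps_expansion_unique_complex by blast
qed

lemma bounded_taylor_coeff_le:
  assumes hol: "f holomorphic_on \<bbbD>" and bd: "\<And>z. z \<in> \<bbbD> \<Longrightarrow> cmod (f z) \<le> 1"
  shows "cmod (taylor_coeff f n) \<le> 1"
proof (rule tendsto_upperbound)
  show "((\<lambda>r. cmod (taylor_coeff f n) * r ^ n) \<longlongrightarrow> cmod (taylor_coeff f n)) (at_left 1)"
    by (auto intro!: tendsto_eq_intros)
  have "cmod (taylor_coeff f n) * r ^ n \<le> 1" if r: "0 < r" "r < 1" for r :: real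
  proof -
    have "cmod ((deriv ^^ n) f 0) \<le> fact n * 1 / r ^ n"
    proof (rule Cauchy_inequality)
      show "f holomorphic_on ball 0 r" using r by (intro holomorphic_on_subset[OF hol]) auto
      show "continuous_on (cball 0 r) f"
        using r by (intro holomorphic_on_imp_continuous_on holomorphic_on_subset[OF hol]) auto
    qed (use r bd in auto)
    thus ?thesis using r by (simp add: fps_expansion_def norm_divide field_simps)
  qed
  moreover have "eventually (\<lambda>r::real. r \<in> {0<..<1}) (at_left 1)"
    by (intro eventually_at_leftI[of 0]) auto
  ultimately show "eventually (\<lambda>r. cmod (taylor_coeff f n) * r ^ n \<le> 1) (at_left 1)"
    by (auto elim: eventually_mono)
qed auto

definition caratheodory :: "(complex \<Rightarrow> complex) \<Rightarrow> bool" where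
  "caratheodory p \<longleftrightarrow> p holomorphic_on \<bbbD> \<and> p 0 = 1 \<and> (\<forall>z\<in>\<bbbD>. Re (p z) > 0)"

lemma caratheodory_taylor_coeff_0:
  "caratheodory p \<Longrightarrow> taylor_coeff p 0 = 1"
  by (simp add: caratheodory_def fps_expansion_def)

text \<open>
  Convex combinations of rotations are Hadamard products: the \<open>n\<close>-th coefficient is multiplied by
  the \<open>n\<close>-th moment of the measure with mass \<open>m j\<close> at \<open>x j\<close>.
\<close>
lemma caratheodory_rotation_average:
  assumes p: "caratheodory p" and fin: "finite J"
    and m: "\<And>j. j \<in> J \<Longrightarrow> 0 \<le> m j" "sum m J = 1"
    and x: "\<And>j. j \<in> J \<Longrightarrow> cmod (x j) = 1"
  defines "P \<equiv> (\<lambda>z. \<Sum>j\<in>J. complex_of_real (m j) * p (x j * z))"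
  shows "caratheodory P"
    and "taylor_coeff P n = (\<Sum>j\<in>J. complex_of_real (m j) * x j ^ n) * taylor_coeff p n"
proof -
  have hol: "p holomorphic_on \<bbbD>" and p0: "p 0 = 1" and re: "\<And>z. z \<in> \<bbbD> \<Longrightarrow> 0 < Re (p z)"
    using p by (auto simp: caratheodory_def)
  have dsk: "x j * z \<in> \<bbbD>" if "j \<in> J" "z \<in> \<bbbD>" for j z
    using that x by (simp add: norm_mult)
  have hol_rot: "(\<lambda>z. p (x j * z)) holomorphic_on \<bbbD>" if "j \<in> J" for j
  proof -
    have "(p \<circ> (\<lambda>z. x j * z)) holomorphic_on \<bbbD>"
      by (rule holomorphic_on_compose_gen[OF _ hol])
         (use dsk that in \<open>auto intro!: holomorphic_intros\<close>)
    thus ?thesis by (simp add: o_def)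
  qed
  have "Re (P z) > 0" if z: "z \<in> \<bbbD>" for z
  proof -
    obtain i where i: "i \<in> J" "m i > 0"
      using m by (metis less_eq_real_def sum_nonpos not_one_le_zero)
    have "Re (P z) = (\<Sum>j\<in>J. m j * Re (p (x j * z)))" by (simp add: P_def Re_sum)
    also have "\<dots> > 0"
    proof (rule sum_pos2[OF fin i(1)])
      show "0 < m i * Re (p (x i * z))" using i re[OF dsk[OF i(1) z]] by simp
      show "0 \<le> m j * Re (p (x j * z))" if "j \<in> J" for j
        using m(1)[OF that] re[OF dsk[OF that z]] by simp
    qed
    finally show ?thesis .
  qed
  moreover have "P holomorphic_on \<bbbD>"
    unfolding P_def by (intro holomorphic_intros hol_rot)
  moreover have "P 0 = 1" using m(2) by (simp add: P_def p0 flip: of_real_sum)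
  ultimately show "caratheodory P" by (simp add: caratheodory_def)
  have "(\<lambda>z. p (x j * z)) has_fps_expansion
      fps_compose (fps_expansion p 0) (fps_const (x j) * fps_X)" for j
  proof -
    have "(\<lambda>z. x j * z) has_fps_expansion fps_const (x j) * fps_X"
      by (intro fps_expansion_intros)
    from has_fps_expansion_compose[OF holomorphic_imp_fps[OF hol] this]
    show ?thesis by (simp add: o_def)
  qed
  hence "P has_fps_expansion (\<Sum>j\<in>J. fps_const (complex_of_real (m j)) *
      fps_compose (fps_expansion p 0) (fps_const (x j) * fps_X))"
    unfolding P_def by (intro fps_expansion_intros)
  hence "fps_expansion P 0 = (\<Sum>j\<in>J. fps_const (complex_of_real (m j)) *
      fps_compose (fps_expansion p 0) (fps_const (x j) * fps_X))"
    by (rule fps_expansion_eqI)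
  thus "taylor_coeff P n = (\<Sum>j\<in>J. complex_of_real (m j) * x j ^ n) * taylor_coeff p n"
    by (simp add: fps_sum_nth) (simp add: sum_distrib_right mult.assoc)
qed

lemma root_of_unity_average:
  fixes k n :: nat
  assumes "0 < k" "k \<le> n"
  shows "(\<Sum>j<n. complex_of_real (1 / n) * cis (2 * pi * j / n) ^ k) = (if k = n then 1 else 0)"
proof -
  define w where "w = cis (2 * pi * k / n)"
  have "cis (2 * pi * j / n) ^ k = w ^ j" for j :: nat
    unfolding w_def Complex.DeMoivre by (simp add: mult_ac)
  hence "(\<Sum>j<n. complex_of_real (1 / n) * cis (2 * pi * j / n) ^ k) = (\<Sum>j<n. w ^ j) / n"
    by (simp add: sum_divide_distrib)
  also have "\<dots> = (if k = n then 1 else 0)"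
  proof (cases "k = n")
    case True
    thus ?thesis using assms by (simp add: w_def)
  next
    case False
    have "w \<noteq> 1"
    proof
      assume "w = 1"
      have inj: "inj_on (\<lambda>j. cis (2 * pi * real j / real n)) {..<n}"
        using Complex.bij_betw_roots_unity[of n] assms by (simp add: bij_betw_def)
      have "k = 0"
        by (rule inj_onD[OF inj]) (use \<open>w = 1\<close> assms False in \<open>auto simp: w_def\<close>)
      thus False using assms by simp
    qed
    moreover have "w ^ n = 1"
      unfolding w_def Complex.DeMoivre using assms by (simp add: cis_multiple_2pi)
    ultimately show ?thesis using False by (simp add: geometric_sum)
  qed
  finally show ?thesis .
qed

text \<open>
  Averaging over the \<open>n\<close>-th roots of unity removes the coefficients \<open>1, \<dots>, n - 1\<close> and keeps the
  \<open>n\<close>-th. For the averaged function \<open>P = 1 + p\<^sub>n z\<^sup>n + \<dots>\<close> the bounded function \<open>(P - 1)/(P + 1)\<close> starts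
  with \<open>(p\<^sub>n/2) z\<^sup>n\<close>, and the Cauchy estimate applies.
\<close>
lemma caratheodory_coeff_le_2:
  assumes p: "caratheodory p" and n: "0 < n"
  shows "cmod (taylor_coeff p n) \<le> 2"
proof -
  define P where "P = (\<lambda>z. \<Sum>j<n. complex_of_real (1 / n) * p (cis (2 * pi * j / n) * z))"
  have P: "caratheodory P"
    "taylor_coeff P k = (\<Sum>j<n. complex_of_real (1 / n) * cis (2 * pi * j / n) ^ k) * taylor_coeff p k" for k
    using caratheodory_rotation_average[OF p, of "{..<n}" "\<lambda>_. 1 / n" "\<lambda>j. cis (2 * pi * j / n)"] n
    by (simp_all add: P_def)
  have holP: "P holomorphic_on \<bbbD>" and reP: "\<And>z. z \<in> \<bbbD> \<Longrightarrow> 0 < Re (P z)"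
    using P(1) by (auto simp: caratheodory_def)
  define F where "F = fps_expansion P 0"
  have F: "fps_nth F k = (if k = 0 then 1 else if k = n then taylor_coeff p n else 0)" if "k \<le> n" for k
    using P(2)[of k] root_of_unity_average[of k n] caratheodory_taylor_coeff_0[OF P(1)] that n
    by (auto simp: F_def)
  define W where "W = (\<lambda>z. (P z - 1) / (P z + 1))"
  have nz: "P z + 1 \<noteq> 0" if "z \<in> \<bbbD>" for z
    using reP[OF that] by (auto simp: complex_eq_iff)
  have W: "W holomorphic_on \<bbbD>"
    unfolding W_def by (intro holomorphic_intros holP) (use nz in auto)
  have "cmod (W z) \<le> 1" if "z \<in> \<bbbD>" for z
  proof -
    have "(cmod (P z + 1))\<^sup>2 - (cmod (P z - 1))\<^sup>2 = 4 * Re (P z)"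
      unfolding cmod_power2 by (simp add: power2_eq_square algebra_simps)
    hence "(cmod (P z - 1))\<^sup>2 \<le> (cmod (P z + 1))\<^sup>2" using reP[OF that] by linarith
    hence "cmod (P z - 1) \<le> cmod (P z + 1)" by (rule power2_le_imp_le) simp
    thus ?thesis using nz[OF that] by (simp add: W_def norm_divide)
  qed
  hence "cmod (taylor_coeff W n) \<le> 1" by (intro bounded_taylor_coeff_le W)
  moreover have "taylor_coeff W n = taylor_coeff p n / 2"
  proof -
    have "W has_fps_expansion (F - 1) / (F + 1)"
      unfolding W_def F_def using F[of 0]
      by (intro fps_expansion_intros holomorphic_imp_fps holP) (simp add: F_def)
    hence "fps_expansion W 0 = (F - 1) / (F + 1)" by (rule fps_expansion_eqI)
    hence "fps_expansion W 0 = (F - 1) * inverse (F + 1)"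
      using F[of 0] by (simp add: fps_divide_unit)
    hence "taylor_coeff W n = (\<Sum>i=0..n. fps_nth (F - 1) i * fps_nth (inverse (F + 1)) (n - i))"
      by (simp add: fps_mult_nth)
    also have "\<dots> = (\<Sum>i\<in>{n}. fps_nth (F - 1) i * fps_nth (inverse (F + 1)) (n - i))"
    proof (rule sum.mono_neutral_right)
      have "fps_nth (F - 1) i = 0" if "i < n" for i using F[of i] that by simp
      thus "\<forall>i\<in>{0..n} - {n}. fps_nth (F - 1) i * fps_nth (inverse (F + 1)) (n - i) = 0" by simp
    qed auto
    also have "\<dots> = taylor_coeff p n / 2"
      using F[of n] F[of 0] n by simp
    finally show ?thesis .
  qed
  ultimately show ?thesis by (simp add: norm_divide)
qed

section \<open>A nonlinear functional of the first four coefficients\<close>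

lemma fps_mult_nth_upto_4:
  fixes F G :: "'a::comm_ring_1 fps"
  shows "fps_nth (F * G) 0 = fps_nth F 0 * fps_nth G 0"
    "fps_nth (F * G) 1 = fps_nth F 0 * fps_nth G 1 + fps_nth F 1 * fps_nth G 0"
    "fps_nth (F * G) 2 = fps_nth F 0 * fps_nth G 2 + fps_nth F 1 * fps_nth G 1 + fps_nth F 2 * fps_nth G 0"
    "fps_nth (F * G) 3 = fps_nth F 0 * fps_nth G 3 + fps_nth F 1 * fps_nth G 2
      + fps_nth F 2 * fps_nth G 1 + fps_nth F 3 * fps_nth G 0"
    "fps_nth (F * G) 4 = fps_nth F 0 * fps_nth G 4 + fps_nth F 1 * fps_nth G 3
      + fps_nth F 2 * fps_nth G 2 + fps_nth F 3 * fps_nth G 1 + fps_nth F 4 * fps_nth G 0"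
  by (simp_all add: fps_mult_nth atLeast0_atMost_Suc numeral_eq_Suc algebra_simps)

text \<open>
  The fourth coefficient of \<open>G/(1 + yG) = G - yG\<^sup>2 + y\<^sup>2G\<^sup>3 - y\<^sup>3G\<^sup>4 + \<dots>\<close>, where \<open>G = p - 1\<close>.
\<close>
definition twisted_coeff4 :: "complex \<Rightarrow> (complex \<Rightarrow> complex) \<Rightarrow> complex" where
  "twisted_coeff4 y p = (let g = taylor_coeff p in
     g 4 - y * (2 * g 1 * g 3 + g 2 ^ 2) + 3 * y ^ 2 * g 1 ^ 2 * g 2 - y ^ 3 * g 1 ^ 4)"

text \<open>
  The hypothesis says \<open>|1 - 2y| = 1\<close>. With \<open>p = (1 + w)/(1 - w)\<close> and \<open>x = 1 - 2y\<close>, the quotient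
  \<open>num/den\<close> in the proof is \<open>(1 + xw)/(1 - xw)\<close>, which has positive real part because \<open>|xw| < 1\<close>;
  in terms of \<open>G\<close> it is \<open>1 + x G/(1 + yG)\<close>.
\<close>
lemma twisted_coeff4_le_2:
  assumes p: "caratheodory p" and y: "(cmod y)\<^sup>2 = Re y"
  shows "cmod (twisted_coeff4 y p) \<le> 2"
proof -
  have y2: "(Im y)\<^sup>2 = Re y - (Re y)\<^sup>2" using y by (simp add: cmod_power2)
  have hol: "p holomorphic_on \<bbbD>" and p0: "p 0 = 1" and re: "\<And>z. z \<in> \<bbbD> \<Longrightarrow> 0 < Re (p z)"
    using p by (auto simp: caratheodory_def)
  define num den where "num = (\<lambda>z. (1 - y) * p z + y)" and "den = (\<lambda>z. y * p z + (1 - y))"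
  have key: "Re (num z * cnj (den z)) = Re (p z)" for z
  proof -
    have "Re (num z * cnj (den z))
        = (Re y - (Re y)\<^sup>2 - (Im y)\<^sup>2) * (1 + (Re (p z))\<^sup>2 + (Im (p z))\<^sup>2)
          + (1 - 2 * Re y + 2 * ((Re y)\<^sup>2 + (Im y)\<^sup>2)) * Re (p z)"
      by (simp add: num_def den_def power2_eq_square algebra_simps)
    thus ?thesis by (simp add: y2)
  qed
  have nz: "den z \<noteq> 0" if "z \<in> \<bbbD>" for z
    using key[of z] re[OF that] by auto
  define Q where "Q = (\<lambda>z. num z / den z)"
  have holnd: "num holomorphic_on \<bbbD>" "den holomorphic_on \<bbbD>"
    unfolding num_def den_def by (auto intro!: holomorphic_intros hol)
  have Q: "caratheodory Q"
    unfolding caratheodory_def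
  proof (intro conjI ballI)
    show "Q holomorphic_on \<bbbD>" unfolding Q_def by (intro holomorphic_intros holnd nz)
    show "Q 0 = 1" by (simp add: Q_def num_def den_def p0)
    show "0 < Re (Q z)" if "z \<in> \<bbbD>" for z
    proof -
      have "Q z = num z * cnj (den z) / of_real ((cmod (den z))\<^sup>2)"
        unfolding Q_def by (rule complex_div_cnj)
      hence "Re (Q z) = Re (num z * cnj (den z)) / (cmod (den z))\<^sup>2"
        by (simp only: Re_divide_of_real)
      thus ?thesis using key[of z] re[OF that] nz[OF that] by simp
    qed
  qed
  define F H where "F = fps_expansion p 0" and "H = fps_expansion Q 0"
  have F0: "fps_nth F 0 = 1" "fps_nth H 0 = 1"
    using caratheodory_taylor_coeff_0 p Q by (auto simp: F_def H_def)
  have "Q has_fps_expansion H" unfolding H_def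
    using Q by (intro holomorphic_imp_fps) (simp add: caratheodory_def)
  hence "(\<lambda>z. Q z * den z) has_fps_expansion H * (fps_const y * F + fps_const (1 - y))"
    unfolding den_def F_def by (intro fps_expansion_intros holomorphic_imp_fps hol)
  moreover have "num has_fps_expansion fps_const (1 - y) * F + fps_const y"
    unfolding num_def F_def by (intro fps_expansion_intros holomorphic_imp_fps hol)
  ultimately have "H * (fps_const y * F + fps_const (1 - y)) = fps_const (1 - y) * F + fps_const y"
    by (rule fps_expansion_eq_on_disk) (use nz in \<open>simp add: Q_def\<close>)
  hence eq: "fps_nth (H * (fps_const y * F + fps_const (1 - y))) n =
      fps_nth (fps_const (1 - y) * F + fps_const y) n" for n by simp
  let ?g = "fps_nth F" and ?h = "fps_nth H"
  have h1: "?h 1 = (1 - 2 * y) * ?g 1"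
    using eq[of 1] unfolding fps_mult_nth_upto_4
    by (simp add: F0 del: One_nat_def) (simp add: algebra_simps del: One_nat_def)
  have h2: "?h 2 = (1 - 2 * y) * (?g 2 - y * ?g 1 ^ 2)"
    using eq[of 2] unfolding fps_mult_nth_upto_4
    by (simp add: F0 h1 del: One_nat_def)
      (simp add: algebra_simps power2_eq_square del: One_nat_def)
  have h3: "?h 3 = (1 - 2 * y) * (?g 3 - 2 * y * ?g 1 * ?g 2 + y ^ 2 * ?g 1 ^ 3)"
    using eq[of 3] unfolding fps_mult_nth_upto_4
    by (simp add: F0 h1 h2 del: One_nat_def)
      (simp add: algebra_simps power2_eq_square power3_eq_cube del: One_nat_def)
  have h4: "?h 4 = (1 - 2 * y) * twisted_coeff4 y p"
    using eq[of 4] unfolding fps_mult_nth_upto_4 twisted_coeff4_def Let_def F_def[symmetric]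
    by (simp add: F0 h1 h2 h3 del: One_nat_def)
      (simp add: algebra_simps power2_eq_square power3_eq_cube power4_eq_xxxx del: One_nat_def)
  have "(cmod (1 - 2 * y))\<^sup>2 = 1"
    by (simp add: cmod_power2 y2 power_mult_distrib) (simp add: power2_eq_square algebra_simps)
  hence "cmod (1 - 2 * y) = 1" by (simp add: power2_eq_1_iff) (smt (verit) norm_ge_zero)
  moreover have "cmod (?h 4) \<le> 2"
    unfolding H_def by (rule caratheodory_coeff_le_2[OF Q]) simp
  ultimately show ?thesis by (simp add: h4 norm_mult)
qed

text \<open>
  If \<open>u \<in> [0, 1]\<close>, then \<open>y = u + i \<surd>(u(1 - u))\<close> satisfies \<open>|y|\<^sup>2 = Re y = u\<close>, and the real parts of
  \<open>y, y\<^sup>2, y\<^sup>3\<close> are \<open>u, 2u\<^sup>2 - u, 4u\<^sup>3 - 3u\<^sup>2\<close>. So the mean of the twisted coefficients at \<open>y\<close> and its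
  conjugate is the functional below with \<open>u, u\<^sup>2, u\<^sup>3\<close> in place of \<open>M1, M2, M3\<close>. The functional is
  affine in \<open>(M1, M2, M3)\<close>, hence the convex combination of its values at two nodes.
\<close>
lemma quadrature_functional_le_2:
  fixes M1 M2 M3 :: real
  assumes p: "caratheodory p"
    and M: "0 < M1" "M1 < 1" "M1\<^sup>2 < M2" "M2\<^sup>2 \<le> M1 * M3" "(M1 - M2)\<^sup>2 \<le> (1 - M1) * (M2 - M3)"
  defines "g \<equiv> taylor_coeff p"
  shows "cmod (g 4 - of_real M1 * (2 * g 1 * g 3 + g 2 ^ 2)
           + 3 * of_real (2 * M2 - M1) * g 1 ^ 2 * g 2 - of_real (4 * M3 - 3 * M2) * g 1 ^ 4) \<le> 2"
proof -
  obtain a b s t :: real where q: "a \<in> {0..1}" "b \<in> {0..1}" "0 \<le> s" "0 \<le> t" "s + t = 1"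
    "s * a + t * b = M1" "s * a\<^sup>2 + t * b\<^sup>2 = M2" "s * a ^ 3 + t * b ^ 3 = M3"
    using two_node_quadrature[OF M] by metis
  define L where "L = (\<lambda>u::real. g 4 - of_real u * (2 * g 1 * g 3 + g 2 ^ 2)
    + 3 * of_real (2 * u\<^sup>2 - u) * g 1 ^ 2 * g 2 - of_real (4 * u ^ 3 - 3 * u\<^sup>2) * g 1 ^ 4)"
  have L: "cmod (L u) \<le> 2" if u: "u \<in> {0..1}" for u
  proof -
    define y where "y = Complex u (sqrt (u * (1 - u)))"
    have "0 \<le> u * (1 - u)" using u by simp
    hence im: "(Im y)\<^sup>2 = u - u\<^sup>2"
      by (simp add: y_def) (simp add: power2_eq_square algebra_simps)
    have c: "(cmod y)\<^sup>2 = Re y" "(cmod (cnj y))\<^sup>2 = Re (cnj y)"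
      by (simp_all add: cmod_power2 im) (simp_all add: y_def)
    have s1: "y + cnj y = of_real (2 * u)" by (simp add: y_def complex_eq_iff)
    have pr: "y * cnj y = of_real u"
      unfolding complex_mult_cnj im by (simp add: y_def)
    have s2: "y ^ 2 + cnj y ^ 2 = of_real (4 * u\<^sup>2 - 2 * u)"
    proof -
      have "y ^ 2 + cnj y ^ 2 = (y + cnj y) ^ 2 - 2 * (y * cnj y)"
        by (simp add: power2_eq_square algebra_simps)
      thus ?thesis unfolding s1 pr by (simp add: power2_eq_square)
    qed
    have s3: "y ^ 3 + cnj y ^ 3 = of_real (8 * u ^ 3 - 6 * u\<^sup>2)"
    proof -
      have "y ^ 3 + cnj y ^ 3 = (y + cnj y) ^ 3 - 3 * (y * cnj y) * (y + cnj y)"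
        by (simp add: power3_eq_cube algebra_simps)
      thus ?thesis unfolding s1 pr by (simp add: power2_eq_square power3_eq_cube)
    qed
    have "twisted_coeff4 y p + twisted_coeff4 (cnj y) p
        = 2 * g 4 - (y + cnj y) * (2 * g 1 * g 3 + g 2 ^ 2)
          + 3 * (y ^ 2 + cnj y ^ 2) * g 1 ^ 2 * g 2 - (y ^ 3 + cnj y ^ 3) * g 1 ^ 4"
      by (simp add: twisted_coeff4_def Let_def g_def algebra_simps)
    also have "\<dots> = 2 * L u"
      unfolding s1 s2 s3 L_def by (simp add: algebra_simps)
    finally have "2 * cmod (L u) = cmod (twisted_coeff4 y p + twisted_coeff4 (cnj y) p)"
      by (simp add: norm_mult)
    thus ?thesis
      using norm_triangle_ineq[of "twisted_coeff4 y p" "twisted_coeff4 (cnj y) p"]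
        c[THEN twisted_coeff4_le_2[OF p]] by linarith
  qed
  have "g 4 - of_real M1 * (2 * g 1 * g 3 + g 2 ^ 2)
      + 3 * of_real (2 * M2 - M1) * g 1 ^ 2 * g 2 - of_real (4 * M3 - 3 * M2) * g 1 ^ 4
      = of_real (s + t) * g 4 - of_real (s * a + t * b) * (2 * g 1 * g 3 + g 2 ^ 2)
      + 3 * of_real (2 * (s * a\<^sup>2 + t * b\<^sup>2) - (s * a + t * b)) * g 1 ^ 2 * g 2
      - of_real (4 * (s * a ^ 3 + t * b ^ 3) - 3 * (s * a\<^sup>2 + t * b\<^sup>2)) * g 1 ^ 4"
    unfolding q by simp
  also have "\<dots> = of_real s * L a + of_real t * L b"
    by (simp add: L_def algebra_simps)
  also have "cmod \<dots> \<le> s * cmod (L a) + t * cmod (L b)"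
    using norm_triangle_ineq[of "of_real s * L a" "of_real t * L b"] q(3,4) by (simp add: norm_mult)
  also have "\<dots> \<le> s * 2 + t * 2" by (intro add_mono mult_left_mono L q)
  also have "\<dots> = 2" using q(5) by (simp add: algebra_simps)
  finally show ?thesis .
qed

text \<open>
  The masses at \<open>1, -1, i, -i\<close> are \<open>(1 + \<surd>\<rho>)\<^sup>2/4, (1 - \<surd>\<rho>)\<^sup>2/4, (1 - \<rho>)/4, (1 - \<rho>)/4\<close>. Their first
  four moments are \<open>\<surd>\<rho>, \<rho>, \<surd>\<rho>, 1\<close>.
\<close>
lemma caratheodory_rescale:
  assumes p: "caratheodory p" and \<rho>: "0 < \<rho>" "\<rho> < 1"
  obtains P where "caratheodory P"
    "taylor_coeff P 1 = of_real (sqrt \<rho>) * taylor_coeff p 1"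
    "taylor_coeff P 2 = of_real \<rho> * taylor_coeff p 2"
    "taylor_coeff P 3 = of_real (sqrt \<rho>) * taylor_coeff p 3"
    "taylor_coeff P 4 = taylor_coeff p 4"
proof -
  define r where "r = sqrt \<rho>"
  have rho: "\<rho> = r\<^sup>2" using \<rho> by (simp add: r_def)
  define m :: "nat \<Rightarrow> real" where
    "m j = (if j = 0 then (1 + r)\<^sup>2 / 4 else if j = 2 then (1 - r)\<^sup>2 / 4 else (1 - \<rho>) / 4)" for j
  have m0: "0 \<le> m j" for j using \<rho> by (simp add: m_def)
  have sum: "sum m {..<4} = 1"
    by (simp add: m_def eval_nat_numeral rho) (simp add: power2_eq_square field_simps)
  define P where "P = (\<lambda>z. \<Sum>j<4. complex_of_real (m j) * p (\<i> ^ j * z))"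
  note avg = caratheodory_rotation_average[OF p finite_lessThan m0 sum, of "\<lambda>j. \<i> ^ j", folded P_def]
  have coeff: "taylor_coeff P n = (\<Sum>j<4. complex_of_real (m j) * (\<i> ^ j) ^ n) * taylor_coeff p n" for n
    by (rule avg) (simp add: norm_power)
  have w: "(\<Sum>j<4. complex_of_real (m j) * (\<i> ^ j) ^ n) =
     of_real ((1 + r)\<^sup>2 / 4) + of_real ((1 - \<rho>) / 4) * \<i> ^ n
      + of_real ((1 - r)\<^sup>2 / 4) * (- 1) ^ n + of_real ((1 - \<rho>) / 4) * (- \<i>) ^ n" for n
    by (simp add: m_def lessThan_nat_numeral power3_eq_cube)
  have id: "(1 + r)\<^sup>2 / 4 - (1 - r)\<^sup>2 / 4 = r"
    "(1 + r)\<^sup>2 / 4 + (1 - r)\<^sup>2 / 4 - 2 * ((1 - \<rho>) / 4) = \<rho>"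
    "(1 + r)\<^sup>2 / 4 + (1 - r)\<^sup>2 / 4 + (1 - \<rho>) / 2 = 1"
    unfolding rho by (simp_all add: power2_eq_square field_simps)
  note id' = id[THEN arg_cong[of _ _ complex_of_real], unfolded of_real_add of_real_diff of_real_mult]
  show ?thesis
  proof (rule that[of P])
    show "caratheodory P" by (rule avg) (simp add: norm_power)
    show "taylor_coeff P 1 = of_real (sqrt \<rho>) * taylor_coeff p 1"
      unfolding coeff w r_def[symmetric] by (subst id'(1)[symmetric]) simp
    show "taylor_coeff P 2 = of_real \<rho> * taylor_coeff p 2"
      unfolding coeff w by (subst id'(2)[symmetric]) simp
    show "taylor_coeff P 3 = of_real (sqrt \<rho>) * taylor_coeff p 3"
      unfolding coeff w r_def[symmetric] by (subst id'(1)[symmetric]) (simp add: power3_eq_cube)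
    show "taylor_coeff P 4 = taylor_coeff p 4"
    proof -
      have "of_real ((1 + r)\<^sup>2 / 4) + of_real ((1 - \<rho>) / 4) * \<i> ^ 4
        + of_real ((1 - r)\<^sup>2 / 4) * (- 1) ^ 4 + of_real ((1 - \<rho>) / 4) * (- \<i>) ^ 4 = (1 :: complex)"
        using id'(3) by (simp add: power4_eq_xxxx add_ac)
      thus ?thesis unfolding coeff w by simp
    qed
  qed
qed

lemma rescaled_functional_le_2:
  fixes \<rho> M1 M2 M3 :: real
  assumes p: "caratheodory p" and \<rho>: "0 < \<rho>" "\<rho> < 1"
    and M: "0 < M1" "M1 < 1" "M1\<^sup>2 < M2" "M2\<^sup>2 \<le> M1 * M3" "(M1 - M2)\<^sup>2 \<le> (1 - M1) * (M2 - M3)"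
  defines "g \<equiv> taylor_coeff p"
  shows "cmod (g 4 - 2 * of_real (\<rho> * M1) * g 1 * g 3 - of_real (\<rho>\<^sup>2 * M1) * g 2 ^ 2
           + of_real (3 * \<rho>\<^sup>2 * (2 * M2 - M1)) * g 1 ^ 2 * g 2
           - of_real (\<rho>\<^sup>2 * (4 * M3 - 3 * M2)) * g 1 ^ 4) \<le> 2"
proof -
  obtain P where P: "caratheodory P"
    "taylor_coeff P 1 = of_real (sqrt \<rho>) * g 1" "taylor_coeff P 2 = of_real \<rho> * g 2"
    "taylor_coeff P 3 = of_real (sqrt \<rho>) * g 3" "taylor_coeff P 4 = g 4"
    unfolding g_def by (rule caratheodory_rescale[OF p \<rho>])
  define r :: complex where "r = of_real (sqrt \<rho>)"
  have r: "of_real \<rho> = r * r" using \<rho> by (simp add: r_def flip: of_real_mult)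
  show ?thesis
    using quadrature_functional_le_2[OF P(1) M] unfolding P(2-5) of_real_mult of_real_power r r_def[symmetric]
    by (simp add: power2_eq_square power4_eq_xxxx algebra_simps)
qed

section \<open>Moments determined by the coefficients of \<open>\<phi>\<close>\<close>

text \<open>
  Matching coefficients determines \<open>\<rho>\<close> and the moments: up to sign, the right-hand sides of the
  last four equations are the coefficients of \<open>p\<^sub>1p\<^sub>3\<close> (halved), \<open>p\<^sub>2\<^sup>2\<close>, \<open>p\<^sub>1\<^sup>2p\<^sub>2\<close> and \<open>p\<^sub>1\<^sup>4\<close> in
  \<open>40 a\<^sub>5\<close>. The quotient of the first two is the quotient in \<open>C4\<close>, so this is the value of \<open>\<rho>\<close>. What remains is that \<open>C1\<close> is equivalent to \<open>0 < M1 < 1\<close>, that then \<open>C2\<close> is equivalent to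
  \<open>|\<gamma> - M1\<^sup>2| < M1 - M1\<^sup>2\<close> with \<open>\<gamma> = 2 M2 - M1\<close>, and that \<open>C3\<close> is equivalent to
  \<open>|(1 - M1) d - M1 d'| < (1 - M1) d + M1 d'\<close>, where \<open>d\<close> and \<open>d'\<close> are the two determinants that
  are to be positive. The first factor of the right-hand side of \<open>C3\<close> is a multiple of the
  denominator \<open>R\<close> of \<open>M1\<close>, and the other two are multiples of \<open>M1 - M2\<close> and \<open>M2 - M1\<^sup>2\<close>.
\<close>
lemma fifth_coeff_moments:
  fixes B1 B2 B3 B4 :: real
  assumes B1: "B1 > 0" 
    and C1: "\<bar>B1^3 - 2*B1*B2 + 2*B2^2\<bar> < \<bar>2*B1^2 - B1^3 - 2*B1*B2\<bar>"
    and C2: "\<bar>B1^3 - B1^2*B2 + 3*B2^2 - 3*B1*B3\<bar> < 3 * \<bar>B1^3 - B1^2 + B2^2\<bar>"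
    and C3: "\<bar>B1^7 - B1^6*(8*B2 + 3)
              - 6*B1^4*(B2*(3*B2 + 2*B3 + 2) - 6*B3 + 9*B4)
              + B1^5*(7*B2*(B2 + 4) - 24*B3 + 18*B4)
              + 6*B1^3*(B2^3 - 2*B2^2 + 8*B2*B3 - 3*B3^2 + 6*(B2 + 1)*B4)
              - 6*B1*B2*(3*B2^3 - 6*B3^2 + B2^2*(4*B3 - 6) + 6*B2*(B4 - 2*B3))
              + 18*B2^2*(- 2*B3^2 + B2*((B2 - 2)*B2 + 2*B4))
              + B1^2*B2*(B2*(B2*(5*B2 + 6) - 24*B3 + 18*B4) - 36*(2*B3 + B4))\<bar>
            < 2 * \<bar>((B1 - 2)*B1 + 2*B2) * (B1*(2*B1 + B2 - 3) + 3*B3)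
                   * (4*B1^3 + 6*B2^2 - B1^2*(B2 + 3) - 3*B1*B3)\<bar>"
    and C4: "0 < (2*B1 - B1^2 - 2*B2) / (2*(B1 - B2))"
            "(2*B1 - B1^2 - 2*B2) / (2*(B1 - B2)) < 1"
  obtains \<rho> M1 M2 M3 :: real where "0 < \<rho>" "\<rho> < 1" "0 < M1" "M1 < 1" "M1\<^sup>2 < M2"
    "M2\<^sup>2 \<le> M1 * M3" "(M1 - M2)\<^sup>2 \<le> (1 - M1) * (M2 - M3)"
    "B1 * \<rho> * M1 = (B1 - B2) / 2" "B1 * \<rho>\<^sup>2 * M1 = (B1 - B2) / 2 - B1\<^sup>2 / 4"
    "3 * B1 * \<rho>\<^sup>2 * (2 * M2 - M1) = (3 * (B1 - 2 * B2 + B3) + (B2 - B1) * B1) / 4"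
    "B1 * \<rho>\<^sup>2 * (4 * M3 - 3 * M2) = (2 * (B1 - 3 * B2 + 3 * B3 - B4) - (B1 - B2)\<^sup>2) / 16"
proof -
  \<comment> \<open>Normalized so that the powers of \<open>B1\<close> cancel from all hypotheses.\<close>
  define q where "q = B2 / B1"
  define r where "r = B3 / B1"
  define w where "w = B4 / B1"
  have B2: "B2 = B1 * q" and B3: "B3 = B1 * r" and B4: "B4 = B1 * w"
    using B1 by (simp_all add: q_def r_def w_def)
  define R e where "R = 2 - 2 * q - B1" and "e = 1 - q"
  define \<rho> where "\<rho> = R / (2 * e)"
  have "(2*B1 - B1^2 - 2*B2) / (2*(B1 - B2)) = \<rho>"
    using B1 unfolding \<rho>_def R_def e_def B2
    by (cases "q = 1") (simp_all add: divide_simps power2_eq_square, simp_all add: algebra_simps)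
  hence \<rho>: "0 < \<rho>" "\<rho> < 1" using C4 by simp_all
  have enz: "e \<noteq> 0" using \<rho> by (auto simp: \<rho>_def)
  have "1 - \<rho> = B1 / (2 * e)" using enz by (simp add: \<rho>_def R_def e_def field_simps)
  hence "0 < B1 / (2 * e)" using \<rho> by simp
  hence e: "e > 0" using B1 by (simp add: zero_less_divide_iff)
  hence R: "R > 0" using \<rho> by (simp add: \<rho>_def zero_less_divide_iff)
  have "B1^3 - 2*B1*B2 + 2*B2^2 = B1\<^sup>2 * (B1 - 2 * q + 2 * q\<^sup>2)"
    "2*B1^2 - B1^3 - 2*B1*B2 = B1\<^sup>2 * R"
    by (simp_all add: B2 R_def power2_eq_square power3_eq_cube algebra_simps)
  hence C1': "\<bar>B1 - 2 * q + 2 * q\<^sup>2\<bar> < R" using C1 B1 R by (simp add: abs_mult)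
  define k where "k = 1 - B1 - q\<^sup>2"
  have k: "k > 0" "e\<^sup>2 < R"
    using C1' by (auto simp: k_def R_def e_def power2_eq_square algebra_simps abs_if split: if_splits)
  have "B1^3 - B1^2*B2 + 3*B2^2 - 3*B1*B3 = B1\<^sup>2 * (B1 - B1 * q + 3 * q\<^sup>2 - 3 * r)"
    "B1^3 - B1^2 + B2^2 = B1\<^sup>2 * (- k)"
    by (simp_all add: B2 B3 k_def power2_eq_square power3_eq_cube algebra_simps)
  hence C2': "\<bar>B1 - B1 * q + 3 * q\<^sup>2 - 3 * r\<bar> < 3 * k" using C2 B1 k by (simp add: abs_mult)
  \<comment> \<open>The two cases of the absolute value in \<open>C2\<close>.\<close>
  define S where "S = 3 - 2 * B1 - B1 * q - 3 * r"
  define T where "T = 3 - 4 * B1 + B1 * q - 6 * q\<^sup>2 + 3 * r"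
  have S: "S > 0" and T: "T > 0" using C2' by (auto simp: S_def T_def k_def abs_if split: if_splits)
  \<comment> \<open>\<open>X\<close> and \<open>Y\<close> are the coefficients of \<open>p\<^sub>1\<^sup>2p\<^sub>2\<close> and \<open>p\<^sub>1\<^sup>4\<close> in \<open>40 a\<^sub>5 / B1\<close>.\<close>
  define X where "X = (3 * (1 - 2 * q + r) + (q - 1) * B1) / 4"
  define Y where "Y = (B1 * (1 - q)\<^sup>2 - 2 * (1 - 3 * q + 3 * r - w)) / 16"
  define M1 where "M1 = e\<^sup>2 / R"
  define M2 where "M2 = e\<^sup>2 * (3 * R + 4 * X) / (6 * R\<^sup>2)"
  define M3 where "M3 = e\<^sup>2 * (3 * R + 4 * X - 8 * Y) / (8 * R\<^sup>2)"
  have RX: "3 * R + 4 * X = 9 - 12 * q - 4 * B1 + 3 * r + q * B1"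
  proof -
    have "4 * X = 3 * (1 - 2 * q + r) + (q - 1) * B1" by (simp add: X_def)
    thus ?thesis by (simp add: R_def algebra_simps)
  qed
  have d12: "M1 - M2 = e\<^sup>2 * S / (6 * R\<^sup>2)"
    using R unfolding M1_def M2_def RX
    by (simp add: divide_simps power2_eq_square) (simp add: S_def R_def algebra_simps)
  have v: "M2 - M1\<^sup>2 = e\<^sup>2 * T / (6 * R\<^sup>2)"
    using R unfolding M1_def M2_def RX
    by (simp add: divide_simps power2_eq_square)
      (simp add: T_def R_def e_def algebra_simps power2_eq_square)
  have M1: "0 < M1" "M1 < 1" using k R e by (simp_all add: M1_def)
  have vp: "M2 - M1\<^sup>2 > 0" unfolding v using T e R by simp
  define d where "d = M1 * M3 - M2\<^sup>2"
  define d' where "d' = (1 - M1) * (M2 - M3) - (M1 - M2)\<^sup>2"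
  define N where "N = B1^7 - B1^6*(8*B2 + 3)
              - 6*B1^4*(B2*(3*B2 + 2*B3 + 2) - 6*B3 + 9*B4)
              + B1^5*(7*B2*(B2 + 4) - 24*B3 + 18*B4)
              + 6*B1^3*(B2^3 - 2*B2^2 + 8*B2*B3 - 3*B3^2 + 6*(B2 + 1)*B4)
              - 6*B1*B2*(3*B2^3 - 6*B3^2 + B2^2*(4*B3 - 6) + 6*B2*(B4 - 2*B3))
              + 18*B2^2*(- 2*B3^2 + B2*((B2 - 2)*B2 + 2*B4))
              + B1^2*B2*(B2*(B2*(5*B2 + 6) - 24*B3 + 18*B4) - 36*(2*B3 + B4))"
  have "((B1 - 2)*B1 + 2*B2) = - (B1 * R)" "(B1*(2*B1 + B2 - 3) + 3*B3) = - (B1 * S)"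
     "(4*B1^3 + 6*B2^2 - B1^2*(B2 + 3) - 3*B1*B3) = - (B1\<^sup>2 * T)"
    by (simp_all add: B2 B3 R_def S_def T_def power2_eq_square power3_eq_cube algebra_simps)
  hence C3': "\<bar>N\<bar> < 2 * \<bar>B1 * R * (B1 * S) * (B1\<^sup>2 * T)\<bar>"
    using C3 unfolding N_def[symmetric] by (simp add: abs_mult)
  have N: "\<bar>N\<bar> < 2 * B1 ^ 4 * R * S * T" 
    using C3' B1 R S T by (simp add: abs_mult power2_eq_square power4_eq_xxxx mult_ac)
  have diff: "(1 - M1) * d - M1 * d' = - (e ^ 4 / (72 * R ^ 5)) * (N / B1 ^ 4)"
  proof -
    define m n where "m = 3 * R + 4 * X" and "n = m - 8 * Y"
    have d: "d = e ^ 4 * (9 * R * n - 2 * m\<^sup>2) / (72 * R ^ 4)"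
      unfolding d_def M1_def M2_def M3_def m_def[symmetric] n_def[symmetric]
      using R by (simp add: divide_simps) (simp add: algebra_simps power2_eq_square eval_nat_numeral)
    have n: "2 * n = 20 - 30 * q + 12 * r - 2 * w - 8 * B1 + 2 * q * B1 - B1 * (1 - q)\<^sup>2"
    proof -
      have "16 * Y = B1 * (1 - q)\<^sup>2 - 2 * (1 - 3 * q + 3 * r - w)" by (simp add: Y_def)
      thus ?thesis unfolding n_def m_def RX by (simp add: algebra_simps)
    qed
    have "2 * (R - e\<^sup>2) * (9 * R * n - 2 * m\<^sup>2) = (R - e\<^sup>2) * (9 * R * (2 * n) - 4 * m\<^sup>2)"
      by (simp add: algebra_simps)
    moreover have "N = - (B1 ^ 4 * ((R - e\<^sup>2) * (9 * R * (2 * n) - 4 * m\<^sup>2) - 2 * R * T * S))"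
      unfolding n m_def RX
      by (simp add: N_def R_def S_def T_def e_def B2 B3 B4
            algebra_simps power2_eq_square eval_nat_numeral)
    ultimately have poly:
      "N / B1 ^ 4 = - (2 * (R - e\<^sup>2) * (9 * R * n - 2 * m\<^sup>2) - 2 * R * T * S)"
      using B1 by simp
    have "(1 - M1) * d - M1 * d' = 2 * (1 - M1) * d - (M2 - M1\<^sup>2) * (M1 - M2)"
      by (simp add: d_def d'_def power2_eq_square algebra_simps)
    also have "\<dots> = (e ^ 4 / (72 * R ^ 5)) * (2 * (R - e\<^sup>2) * (9 * R * n - 2 * m\<^sup>2) - 2 * R * T * S)"
      unfolding v d12 d unfolding M1_def using R
      by (simp add: divide_simps) (simp add: algebra_simps power2_eq_square eval_nat_numeral)
    also have "\<dots> = - (e ^ 4 / (72 * R ^ 5)) * (N / B1 ^ 4)"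
      unfolding poly by (simp only: minus_mult_minus)
    finally show ?thesis .
  qed
  have sum: "(1 - M1) * d + M1 * d' = (e ^ 4 / (72 * R ^ 5)) * (2 * R * S * T)"
  proof -
    have "(1 - M1) * d + M1 * d' = (M2 - M1\<^sup>2) * (M1 - M2)"
      by (simp add: d_def d'_def power2_eq_square algebra_simps)
    also have "\<dots> = (e ^ 4 / (72 * R ^ 5)) * (2 * R * S * T)"
      unfolding v d12 using R by (simp add: divide_simps) (simp add: algebra_simps power2_eq_square eval_nat_numeral)
    finally show ?thesis .
  qed
  have "\<bar>N / B1 ^ 4\<bar> < 2 * R * S * T" using N B1 by (simp add: abs_mult divide_simps mult_ac)
  hence "\<bar>(1 - M1) * d - M1 * d'\<bar> < (1 - M1) * d + M1 * d'"
  proof -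
    have K: "e ^ 4 / (72 * R ^ 5) > 0" using e R by simp
    have "\<bar>(1 - M1) * d - M1 * d'\<bar> = e ^ 4 / (72 * R ^ 5) * \<bar>N / B1 ^ 4\<bar>"
      unfolding diff by (simp only: abs_mult abs_minus_cancel abs_of_pos[OF K])
    also have "\<dots> < (1 - M1) * d + M1 * d'"
      unfolding sum using \<open>\<bar>N / B1 ^ 4\<bar> < _\<close> K by (rule mult_strict_left_mono)
    finally show ?thesis .
  qed
  hence "(1 - M1) * d > 0" "M1 * d' > 0" by (auto simp: abs_if split: if_splits)
  hence dd: "d > 0" "d' > 0" using M1 by (simp_all add: zero_less_mult_iff)
  show ?thesis
  proof (rule that[of \<rho> M1 M2 M3])
    show "B1 * \<rho> * M1 = (B1 - B2) / 2"
      using R e by (simp add: \<rho>_def M1_def B2 power2_eq_square) (simp add: e_def algebra_simps)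
    show "B1 * \<rho>\<^sup>2 * M1 = (B1 - B2) / 2 - B1\<^sup>2 / 4"
      using R e by (simp add: \<rho>_def M1_def B2 power2_eq_square) (simp add: R_def algebra_simps)
    show "3 * B1 * \<rho>\<^sup>2 * (2 * M2 - M1) = (3 * (B1 - 2 * B2 + B3) + (B2 - B1) * B1) / 4"
    proof -
      have "3 * \<rho>\<^sup>2 * (2 * M2 - M1) = X" 
        using R e by (simp add: \<rho>_def M1_def M2_def divide_simps power2_eq_square) (simp add: algebra_simps)
      hence "3 * B1 * \<rho>\<^sup>2 * (2 * M2 - M1) = B1 * X" by (simp add: mult_ac)
      thus ?thesis by (simp add: X_def B2 B3 algebra_simps)
    qed
    show "B1 * \<rho>\<^sup>2 * (4 * M3 - 3 * M2) = (2 * (B1 - 3 * B2 + 3 * B3 - B4) - (B1 - B2)\<^sup>2) / 16"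
    proof -
      have "\<rho>\<^sup>2 * (4 * M3 - 3 * M2) = - Y" 
        using R e by (simp add: \<rho>_def M3_def M2_def divide_simps power2_eq_square) (simp add: algebra_simps)
      hence "B1 * \<rho>\<^sup>2 * (4 * M3 - 3 * M2) = B1 * (- Y)" by (metis mult.assoc)
      also have "- Y = (2 * (1 - 3 * q + 3 * r - w) - B1 * (1 - q)\<^sup>2) / 16"
        by (simp add: Y_def field_simps)
      finally show ?thesis by (simp add: B2 B3 B4 power2_eq_square algebra_simps)
    qed
  qed (use \<rho> M1 vp dd in \<open>auto simp: d_def d'_def\<close>)
qed

section \<open>The fifth coefficient in terms of a Schwarz function\<close>

text \<open>
  The even coefficients of \<open>f(z) - f(-z)\<close> vanish, so only \<open>a\<^sub>3\<close> enters the equation for \<open>a\<^sub>5\<close>: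
  \<open>6 a\<^sub>3 = d\<^sub>2\<close> and \<open>20 a\<^sub>5 = d\<^sub>4 + 3 a\<^sub>3 d\<^sub>2\<close>, where \<open>d\<^sub>n\<close> are the coefficients of \<open>\<phi> \<circ> \<omega>\<close>.
\<close>
lemma fifth_coeff_formula:
  assumes hol: "\<phi> holomorphic_on \<bbbD>" and f: "f \<in> \<A>"
    and \<omega>: "\<omega> holomorphic_on \<bbbD>" "\<omega> ` \<bbbD> \<subseteq> \<bbbD>" "\<omega> 0 = 0"
    and \<phi>0: "\<phi> 0 = 1" and re: "\<And>z. z \<in> \<bbbD> \<Longrightarrow> Re (\<phi> z) > 0"
    and eq: "\<And>z. z \<in> \<bbbD> \<Longrightarrow>
      deriv (\<lambda>w. 2 * w * deriv f w) z / deriv (\<lambda>w. f w - f (- w)) z = \<phi> (\<omega> z)"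
  defines "b \<equiv> taylor_coeff \<phi>" and "c \<equiv> taylor_coeff \<omega>"
  shows "20 * taylor_coeff f 5 = b 1 * c 4 + b 2 * (2 * c 1 * c 3 + c 2 ^ 2)
    + 3 * b 3 * c 1 ^ 2 * c 2 + b 4 * c 1 ^ 4 + (b 1 * c 2 + b 2 * c 1 ^ 2) ^ 2 / 2"
proof -
  have holf: "f holomorphic_on \<bbbD>" and f0: "f 0 = 0" and f1: "deriv f 0 = 1"
    using f by (auto simp: normalized_class_def)
  define F C \<Phi> where "F = fps_expansion f 0" and "C = fps_expansion \<omega> 0" and "\<Phi> = fps_expansion \<phi> 0"
  have F1: "fps_nth F 1 = 1" by (simp add: F_def fps_expansion_def f1)
  have C0: "fps_nth C 0 = 0" by (simp add: C_def fps_expansion_def \<omega>)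
  have \<Phi>0: "fps_nth \<Phi> 0 = 1" by (simp add: \<Phi>_def fps_expansion_def \<phi>0)
  define N D where "N = fps_deriv (2 * fps_X * fps_deriv F)"
    and "D = fps_deriv (F - fps_compose F (fps_const (- 1) * fps_X))"
  have fF: "f has_fps_expansion F" unfolding F_def by (rule holomorphic_imp_fps[OF holf])
  have N: "(\<lambda>z. deriv (\<lambda>w. 2 * w * deriv f w) z) has_fps_expansion N"
    unfolding N_def by (intro fps_expansion_intros fF)
  have "(\<lambda>w. - 1 * w) has_fps_expansion fps_const (- 1) * (fps_X :: complex fps)"
    by (intro fps_expansion_intros)
  from has_fps_expansion_compose[OF fF this]
  have "(\<lambda>w. f (- w)) has_fps_expansion fps_compose F (fps_const (- 1) * fps_X)"
    by (simp add: o_def)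
  hence D: "(\<lambda>z. deriv (\<lambda>w. f w - f (- w)) z) has_fps_expansion D"
    unfolding D_def by (intro fps_expansion_intros fF)
  define H where "H = fps_compose \<Phi> C"
  have "(\<phi> \<circ> \<omega>) has_fps_expansion H"
    unfolding H_def
    by (rule has_fps_expansion_compose[OF _ _ C0])
       (auto simp: C_def \<Phi>_def intro!: holomorphic_imp_fps hol \<omega>)
  hence "(\<lambda>z. \<phi> (\<omega> z) * deriv (\<lambda>w. f w - f (- w)) z) has_fps_expansion H * D"
    using D by (auto simp: o_def intro: fps_expansion_intros)
  with N have "N = H * D"
  proof (rule fps_expansion_eq_on_disk)
    fix z :: complex assume z: "z \<in> \<bbbD>"
    \<comment> \<open>A zero denominator would make the quotient \<open>0\<close>, which \<open>\<phi>\<close> omits.\<close>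
    have "\<omega> z \<in> \<bbbD>" using z \<omega>(2) by blast
    hence "\<phi> (\<omega> z) \<noteq> 0" using re by force
    hence "deriv (\<lambda>w. f w - f (- w)) z \<noteq> 0" using eq[OF z] by auto
    thus "deriv (\<lambda>w. 2 * w * deriv f w) z = \<phi> (\<omega> z) * deriv (\<lambda>w. f w - f (- w)) z"
      using eq[OF z] by (simp add: field_simps)
  qed
  hence ND: "fps_nth N n = fps_nth (H * D) n" for n by simp
  have Nn: "fps_nth N n = 2 * of_nat (Suc n) ^ 2 * fps_nth F (Suc n)" for n
    by (cases n) (simp_all add: N_def mult.assoc numeral_fps_const power2_eq_square algebra_simps)
  have Dn: "fps_nth D n = of_nat (Suc n) * (1 - (- 1) ^ Suc n) * fps_nth F (Suc n)" for n
    unfolding D_def fps_deriv_nth fps_sub_nth fps_nth_compose_linear by (simp add: algebra_simps)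
  have H0: "fps_nth H 0 = 1" by (simp add: H_def \<Phi>0)
  have H2: "fps_nth H 2 = b 1 * c 2 + b 2 * c 1 ^ 2"
  proof -
    have "{0..2::nat} = {0, 1, 2}" by auto
    thus ?thesis unfolding H_def fps_compose_nth b_def c_def \<Phi>_def[symmetric] C_def[symmetric]
      by (simp add: power2_eq_square fps_mult_nth_upto_4 C0 del: One_nat_def)
  qed
  have H4: "fps_nth H 4 = b 1 * c 4 + b 2 * (2 * c 1 * c 3 + c 2 ^ 2) + 3 * b 3 * c 1 ^ 2 * c 2 + b 4 * c 1 ^ 4"
  proof -
    have "{0..4::nat} = {0, 1, 2, 3, 4}" by auto
    thus ?thesis unfolding H_def fps_compose_nth b_def c_def \<Phi>_def[symmetric] C_def[symmetric]
      by (simp add: power2_eq_square power3_eq_cube power4_eq_xxxx fps_mult_nth_upto_4 C0 del: One_nat_def)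
  qed
  have "6 * fps_nth F 3 = fps_nth H 2"
    using ND[of 2] unfolding fps_mult_nth_upto_4 Nn Dn by (simp add: H0 F1[simplified])
  moreover have "40 * fps_nth F 5 = 2 * fps_nth H 4 + (6 * fps_nth F 3) * fps_nth H 2"
    using ND[of 4] unfolding fps_mult_nth_upto_4 Nn Dn by (simp add: H0 F1[simplified] algebra_simps)
  ultimately have "40 * fps_nth F 5 = 2 * fps_nth H 4 + fps_nth H 2 * fps_nth H 2"
    by (simp only:)
  hence "20 * fps_nth F 5 = fps_nth H 4 + fps_nth H 2 ^ 2 / 2"
    by (simp add: power2_eq_square field_simps)
  thus ?thesis unfolding H2 H4 F_def .
qed

lemma schwarz_imp_caratheodory:
  assumes \<omega>: "\<omega> holomorphic_on \<bbbD>" "\<omega> ` \<bbbD> \<subseteq> \<bbbD>" "\<omega> 0 = 0"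
  defines "c \<equiv> taylor_coeff \<omega>"
  obtains p where "caratheodory p" "taylor_coeff p 1 = 2 * c 1"
    "taylor_coeff p 2 = 2 * (c 2 + c 1 ^ 2)"
    "taylor_coeff p 3 = 2 * (c 3 + 2 * c 1 * c 2 + c 1 ^ 3)"
    "taylor_coeff p 4 = 2 * (c 4 + 2 * c 1 * c 3 + c 2 ^ 2 + 3 * c 1 ^ 2 * c 2 + c 1 ^ 4)"
proof -
  define p where "p = (\<lambda>z. (1 + \<omega> z) / (1 - \<omega> z))"
  have lt: "cmod (\<omega> z) < 1" if "z \<in> \<bbbD>" for z using \<omega>(2) that by force
  have nz: "1 - \<omega> z \<noteq> 0" if "z \<in> \<bbbD>" for z using lt[OF that] by auto
  have p: "caratheodory p" unfolding caratheodory_def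
  proof (intro conjI ballI)
    show "p holomorphic_on \<bbbD>" unfolding p_def by (intro holomorphic_intros \<omega> nz)
    show "p 0 = 1" by (simp add: p_def \<omega>)
    show "Re (p z) > 0" if z: "z \<in> \<bbbD>" for z
    proof -
      have "p z = (1 + \<omega> z) * cnj (1 - \<omega> z) / of_real ((cmod (1 - \<omega> z))\<^sup>2)"
        unfolding p_def by (rule complex_div_cnj)
      hence "Re (p z) = Re ((1 + \<omega> z) * cnj (1 - \<omega> z)) / (cmod (1 - \<omega> z))\<^sup>2"
        by (simp only: Re_divide_of_real)
      also have "Re ((1 + \<omega> z) * cnj (1 - \<omega> z)) = 1 - (cmod (\<omega> z))\<^sup>2"
        unfolding cmod_power2 by (simp add: power2_eq_square algebra_simps)
      finally show ?thesis using lt[OF z] nz[OF z] by (simp add: power_less_one_iff abs_square_less_1)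
    qed
  qed
  define C H where "C = fps_expansion \<omega> 0" and "H = fps_expansion p 0"
  have C0: "fps_nth C 0 = 0" by (simp add: C_def fps_expansion_def \<omega>)
  have H0: "fps_nth H 0 = 1" using caratheodory_taylor_coeff_0[OF p] by (simp add: H_def)
  have "p has_fps_expansion H" unfolding H_def
    using p by (intro holomorphic_imp_fps) (simp add: caratheodory_def)
  hence "(\<lambda>z. p z * (1 - \<omega> z)) has_fps_expansion H * (1 - C)"
    unfolding C_def by (intro fps_expansion_intros holomorphic_imp_fps \<omega>)
  moreover have "(\<lambda>z. 1 + \<omega> z) has_fps_expansion 1 + C"
    unfolding C_def by (intro fps_expansion_intros holomorphic_imp_fps \<omega>)
  ultimately have "H * (1 - C) = 1 + C"
    by (rule fps_expansion_eq_on_disk) (use nz in \<open>simp add: p_def\<close>)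
  hence eq: "fps_nth (H * (1 - C)) n = fps_nth (1 + C) n" for n by simp
  let ?h = "fps_nth H" and ?c = "fps_nth C"
  have h1: "?h 1 = 2 * ?c 1"
    using eq[of 1] unfolding fps_mult_nth_upto_4 by (simp add: C0 H0 algebra_simps del: One_nat_def)
  have h2: "?h 2 = 2 * (?c 2 + ?c 1 ^ 2)"
    using eq[of 2] unfolding fps_mult_nth_upto_4
    by (simp add: C0 H0 h1 algebra_simps power2_eq_square del: One_nat_def)
  have h3: "?h 3 = 2 * (?c 3 + 2 * ?c 1 * ?c 2 + ?c 1 ^ 3)"
    using eq[of 3] unfolding fps_mult_nth_upto_4
    by (simp add: C0 H0 h1 h2 algebra_simps power2_eq_square power3_eq_cube del: One_nat_def)
  have h4: "?h 4 = 2 * (?c 4 + 2 * ?c 1 * ?c 3 + ?c 2 ^ 2 + 3 * ?c 1 ^ 2 * ?c 2 + ?c 1 ^ 4)"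
    using eq[of 4] unfolding fps_mult_nth_upto_4
    by (simp add: C0 H0 h1 h2 h3 algebra_simps power2_eq_square power3_eq_cube power4_eq_xxxx
          del: One_nat_def)
  show ?thesis
    by (rule that[OF p]) (use h1 h2 h3 h4 in \<open>simp_all add: c_def C_def H_def\<close>)
qed

section \<open>An extremal function\<close>

text \<open>
  For odd \<open>f\<close> the condition \<open>(zf')'/f' = \<phi>(z\<^sup>4)\<close> integrates to
  \<open>f' = exp (\<integral> (\<phi>(z\<^sup>4) - 1)/z dz)\<close>. With \<open>\<phi>(z) = 1 + z k(z)\<close> and \<open>K' = k\<close> the exponent is
  \<open>(K(z\<^sup>4) - K(0))/4\<close>, which makes \<open>f'\<close> visibly even.
\<close>
lemma extremal_function:
  assumes \<phi>: "\<phi> holomorphic_on \<bbbD>" "\<phi> 0 = 1"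
  obtains f where "f \<in> \<A>"
    "\<And>z. z \<in> \<bbbD> \<Longrightarrow>
       deriv (\<lambda>w. 2 * w * deriv f w) z / deriv (\<lambda>w. f w - f (- w)) z = \<phi> (z ^ 4)"
proof -
  define k where "k = (\<lambda>z. if z = 0 then deriv \<phi> 0 else (\<phi> z - \<phi> 0) / (z - 0))"
  have k: "k holomorphic_on \<bbbD>"
    unfolding k_def by (rule pole_lemma[OF \<phi>(1)]) simp
  have zk: "z * k z = \<phi> z - 1" for z by (simp add: k_def \<phi>)
  obtain K where K: "\<And>z. z \<in> \<bbbD> \<Longrightarrow> (K has_field_derivative k z) (at z)"
    using holomorphic_convex_primitive'[OF _ _ k] by (metis at_within_open convex_ball open_ball)
  define E where "E = (\<lambda>z. exp ((K (z ^ 4) - K 0) / 4))"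
  have pow: "z ^ 4 \<in> \<bbbD>" if "z \<in> \<bbbD>" for z :: complex
    using that by (simp add: norm_power power_less_one_iff)
  have E: "(E has_field_derivative E z * (z ^ 3 * k (z ^ 4))) (at z)" if "z \<in> \<bbbD>" for z
  proof -
    have "((\<lambda>z. K (z ^ 4)) has_field_derivative k (z ^ 4) * (4 * z ^ 3)) (at z)"
      by (rule DERIV_chain2[where f = K and g = "\<lambda>z. z ^ 4", OF K[OF pow[OF that]]]) (auto intro!: derivative_eq_intros)
    thus ?thesis unfolding E_def
      by (auto intro!: derivative_eq_intros)
  qed
  have "E holomorphic_on \<bbbD>"
    unfolding holomorphic_on_open[OF open_ball] using E by blast
  then obtain g where g: "\<And>z. z \<in> \<bbbD> \<Longrightarrow> (g has_field_derivative E z) (at z)"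
    using holomorphic_convex_primitive'[of \<bbbD> E] by (metis at_within_open convex_ball open_ball)
  define f where "f = (\<lambda>z. g z - g 0)"
  have f: "(f has_field_derivative E z) (at z)" if "z \<in> \<bbbD>" for z
    unfolding f_def using g[OF that] by (auto intro!: derivative_eq_intros)
  have even: "E (- z) = E z" for z by (simp add: E_def)
  have df: "deriv f z = E z" if "z \<in> \<bbbD>" for z using f[OF that] by (rule DERIV_imp_deriv)
  have "f holomorphic_on \<bbbD>"
    unfolding holomorphic_on_open[OF open_ball] using f by blast
  hence "f \<in> \<A>"
    unfolding normalized_class_def using df[of 0] by (simp add: f_def E_def)
  moreover have "deriv (\<lambda>w. 2 * w * deriv f w) z / deriv (\<lambda>w. f w - f (- w)) z = \<phi> (z ^ 4)"
    if z: "z \<in> \<bbbD>" for z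
  proof -
    have "eventually (\<lambda>w. w \<in> \<bbbD>) (nhds z)" using z by (intro eventually_nhds_in_open) auto
    hence "eventually (\<lambda>w. 2 * w * deriv f w = 2 * w * E w) (nhds z)"
      by eventually_elim (simp add: df)
    hence "deriv (\<lambda>w. 2 * w * deriv f w) z = deriv (\<lambda>w. 2 * w * E w) z"
      by (rule deriv_cong_ev) simp
    also have "((\<lambda>w. 2 * w * E w) has_field_derivative 2 * E z * (1 + z ^ 4 * k (z ^ 4))) (at z)"
      using E[OF z] by (auto intro!: derivative_eq_intros simp: algebra_simps power4_eq_xxxx power3_eq_cube)
    hence "deriv (\<lambda>w. 2 * w * E w) z = 2 * E z * \<phi> (z ^ 4)"
      unfolding zk by (intro DERIV_imp_deriv) simp
    finally have num: "deriv (\<lambda>w. 2 * w * deriv f w) z = 2 * E z * \<phi> (z ^ 4)" .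
    have "((\<lambda>w. f (- w)) has_field_derivative E (- z) * (- 1)) (at z)"
      by (rule DERIV_chain2[where f = f and g = "\<lambda>w. - w", OF f]) (use z in \<open>auto intro!: derivative_eq_intros\<close>)
    hence "((\<lambda>w. f w - f (- w)) has_field_derivative 2 * E z) (at z)"
      using f[OF z] by (auto intro!: derivative_eq_intros simp: even)
    hence "deriv (\<lambda>w. f w - f (- w)) z = 2 * E z" by (rule DERIV_imp_deriv)
    with num show ?thesis by (simp add: E_def)
  qed
  ultimately show ?thesis by (rule that)
qed

section \<open>The sharp bound\<close>

theorem theorem2p6:
  fixes \<phi> :: "complex \<Rightarrow> complex" and B1 B2 B3 B4 :: real
  assumes \<phi>: "ma_minda \<phi>"
    and B: "B1 = real_coeff \<phi> 1" "B2 = real_coeff \<phi> 2"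
           "B3 = real_coeff \<phi> 3" "B4 = real_coeff \<phi> 4"
    and C1: "\<bar>B1^3 - 2*B1*B2 + 2*B2^2\<bar> < \<bar>2*B1^2 - B1^3 - 2*B1*B2\<bar>"
    and C2: "\<bar>B1^3 - B1^2*B2 + 3*B2^2 - 3*B1*B3\<bar> < 3 * \<bar>B1^3 - B1^2 + B2^2\<bar>"
    and C3: "\<bar>B1^7 - B1^6*(8*B2 + 3)
              - 6*B1^4*(B2*(3*B2 + 2*B3 + 2) - 6*B3 + 9*B4)
              + B1^5*(7*B2*(B2 + 4) - 24*B3 + 18*B4)
              + 6*B1^3*(B2^3 - 2*B2^2 + 8*B2*B3 - 3*B3^2 + 6*(B2 + 1)*B4)
              - 6*B1*B2*(3*B2^3 - 6*B3^2 + B2^2*(4*B3 - 6) + 6*B2*(B4 - 2*B3))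
              + 18*B2^2*(- 2*B3^2 + B2*((B2 - 2)*B2 + 2*B4))
              + B1^2*B2*(B2*(B2*(5*B2 + 6) - 24*B3 + 18*B4) - 36*(2*B3 + B4))\<bar>
            < 2 * \<bar>((B1 - 2)*B1 + 2*B2) * (B1*(2*B1 + B2 - 3) + 3*B3)
                   * (4*B1^3 + 6*B2^2 - B1^2*(B2 + 3) - 3*B1*B3)\<bar>"
    and C4: "0 < (2*B1 - B1^2 - 2*B2) / (2*(B1 - B2))"
            "(2*B1 - B1^2 - 2*B2) / (2*(B1 - B2)) < 1"
  shows "(\<forall>f \<in> \<C>\<^sub>s \<phi>. cmod (taylor_coeff f 5) \<le> B1 / 20) \<and>
         (\<exists>f \<in> \<C>\<^sub>s \<phi>. cmod (taylor_coeff f 5) = B1 / 20)"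
proof -
  have hol: "\<phi> holomorphic_on \<bbbD>" and \<phi>0: "\<phi> 0 = 1" and re: "\<And>z. z \<in> \<bbbD> \<Longrightarrow> Re (\<phi> z) > 0"
    using \<phi> by (auto simp: ma_minda_def)
  have B1: "B1 > 0" using \<phi> by (auto simp: ma_minda_def B real_coeff_def)
  have b: "taylor_coeff \<phi> 1 = of_real B1" "taylor_coeff \<phi> 2 = of_real B2"
    "taylor_coeff \<phi> 3 = of_real B3" "taylor_coeff \<phi> 4 = of_real B4"
    unfolding B by (rule ma_minda_coeff_real[OF \<phi>])+
  show ?thesis
  proof (intro conjI ballI)
    fix f assume "f \<in> \<C>\<^sub>s \<phi>"
    then obtain \<omega> where f: "f \<in> \<A>" and \<omega>: "\<omega> holomorphic_on \<bbbD>" "\<omega> ` \<bbbD> \<subseteq> \<bbbD>" "\<omega> 0 = 0"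
      and eq: "\<And>z. z \<in> \<bbbD> \<Longrightarrow>
        deriv (\<lambda>w. 2 * w * deriv f w) z / deriv (\<lambda>w. f w - f (- w)) z = \<phi> (\<omega> z)"
      unfolding class_Cs_def subordinate_def by blast
    define c where "c = taylor_coeff \<omega>"
    have a5: "20 * taylor_coeff f 5 = B1 * c 4 + B2 * (2 * c 1 * c 3 + c 2 ^ 2)
        + 3 * B3 * c 1 ^ 2 * c 2 + B4 * c 1 ^ 4 + (B1 * c 2 + B2 * c 1 ^ 2) ^ 2 / 2"
      using fifth_coeff_formula[OF hol f \<omega> \<phi>0 re eq] unfolding b c_def
      by (simp del: One_nat_def)
    obtain p where p: "caratheodory p" "taylor_coeff p 1 = 2 * c 1"
      "taylor_coeff p 2 = 2 * (c 2 + c 1 ^ 2)"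
      "taylor_coeff p 3 = 2 * (c 3 + 2 * c 1 * c 2 + c 1 ^ 3)"
      "taylor_coeff p 4 = 2 * (c 4 + 2 * c 1 * c 3 + c 2 ^ 2 + 3 * c 1 ^ 2 * c 2 + c 1 ^ 4)"
      unfolding c_def by (rule schwarz_imp_caratheodory[OF \<omega>])
    obtain \<rho> M1 M2 M3 :: real where \<rho>: "0 < \<rho>" "\<rho> < 1"
      and M: "0 < M1" "M1 < 1" "M1\<^sup>2 < M2"
      "M2\<^sup>2 \<le> M1 * M3" "(M1 - M2)\<^sup>2 \<le> (1 - M1) * (M2 - M3)"
      and match: "B1 * \<rho> * M1 = (B1 - B2) / 2" "B1 * \<rho>\<^sup>2 * M1 = (B1 - B2) / 2 - B1\<^sup>2 / 4"
      "3 * B1 * \<rho>\<^sup>2 * (2 * M2 - M1) = (3 * (B1 - 2 * B2 + B3) + (B2 - B1) * B1) / 4"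
      "B1 * \<rho>\<^sup>2 * (4 * M3 - 3 * M2) = (2 * (B1 - 3 * B2 + 3 * B3 - B4) - (B1 - B2)\<^sup>2) / 16"
      by (rule fifth_coeff_moments[OF B1 C1 C2 C3 C4])
    define g where "g = taylor_coeff p"
    define L where "L = g 4 - 2 * of_real (\<rho> * M1) * g 1 * g 3 - of_real (\<rho>\<^sup>2 * M1) * g 2 ^ 2
           + of_real (3 * \<rho>\<^sup>2 * (2 * M2 - M1)) * g 1 ^ 2 * g 2
           - of_real (\<rho>\<^sup>2 * (4 * M3 - 3 * M2)) * g 1 ^ 4"
    have "of_real B1 * L = B1 * g 4 - 2 * of_real (B1 * \<rho> * M1) * g 1 * g 3
        - of_real (B1 * \<rho>\<^sup>2 * M1) * g 2 ^ 2
        + of_real (3 * B1 * \<rho>\<^sup>2 * (2 * M2 - M1)) * g 1 ^ 2 * g 2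
        - of_real (B1 * \<rho>\<^sup>2 * (4 * M3 - 3 * M2)) * g 1 ^ 4"
      by (simp add: L_def algebra_simps)
    also have "\<dots> = 2 * (20 * taylor_coeff f 5)"
      unfolding match a5 g_def p
      by (simp add: field_simps power2_eq_square power3_eq_cube power4_eq_xxxx)
    finally have "cmod (of_real B1 * L) = cmod (2 * (20 * taylor_coeff f 5))" by simp
    moreover have "cmod L \<le> 2"
      unfolding L_def g_def by (rule rescaled_functional_le_2[OF p(1) \<rho> M])
    hence "B1 * cmod L \<le> B1 * 2" using B1 by (intro mult_left_mono) auto
    ultimately show "cmod (taylor_coeff f 5) \<le> B1 / 20"
      using B1 by (simp add: norm_mult)
  next
    obtain f where f: "f \<in> \<A>" and eq: "\<And>z. z \<in> \<bbbD> \<Longrightarrow>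
       deriv (\<lambda>w. 2 * w * deriv f w) z / deriv (\<lambda>w. f w - f (- w)) z = \<phi> (z ^ 4)"
      using extremal_function[OF hol \<phi>0] by metis
    have \<omega>: "(\<lambda>z. z ^ 4) holomorphic_on \<bbbD>" "(\<lambda>z. z ^ 4) ` \<bbbD> \<subseteq> \<bbbD>" "(0::complex) ^ 4 = 0"
      by (auto intro!: holomorphic_intros simp: norm_power power_less_one_iff)
    have "f \<in> \<C>\<^sub>s \<phi>"
      unfolding class_Cs_def subordinate_def using f eq \<omega> by blast
    have "fps_expansion (\<lambda>z. z ^ 4 :: complex) 0 = fps_X ^ 4"
      by (intro fps_expansion_eqI fps_expansion_intros)
    hence "20 * taylor_coeff f 5 = of_real B1"
      using fifth_coeff_formula[OF hol f \<omega> \<phi>0 re eq] unfolding b by simp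
    hence "taylor_coeff f 5 = of_real (B1 / 20)" by (simp add: field_simps)
    hence "cmod (taylor_coeff f 5) = B1 / 20" using B1 by (simp only: norm_of_real)
    with \<open>f \<in> \<C>\<^sub>s \<phi>\<close> show "\<exists>f \<in> \<C>\<^sub>s \<phi>. cmod (taylor_coeff f 5) = B1 / 20" by blast
  qed
qed

end
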